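(* Let $\alpha\in[0,\pi]$ be such that $z=\cos\alpha$ satisfies $0\le z<1$, and define $f_\alpha:[-1,1]\to\mathbb{R}$ by $f_\alpha(t)=\frac{z-t^2}{1-z}$ if $t<-\sqrt{z}$, $f_\alpha(t)=0$ if $-\sqrt{z}\le t\le z$, and $f_\alpha(t)=\frac{t-z}{1-z}$ if $t>z$. Then for all $n$ and $N$ and every spherical $(n,N,\alpha)$-code $\{\mathbf{x}_1,\ldots,\mathbf{x}_N\}$, with $x_{ij}=\langle\mathbf{x}_i,\mathbf{x}_j\rangle$, the $N\times N$ matrix $(f_\alpha(x_{ij}))$ is diagonally dominant, i.e. $2f_\alpha(x_{ii})\ge\sum_{j=1}^N|f_\alpha(x_{ij})|$ for $1\le i\le N$, and it is positive semidefinite.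
   Context: A spherical $(n,N,\alpha)$-code is a set $\{\mathbf{x}_1,\ldots,\mathbf{x}_N\}$ of $N$ unit vectors in $\mathbb{R}^n$ whose pairwise angular distances are at least $\alpha$, i.e. $\langle\mathbf{x}_i,\mathbf{x}_j\rangle\le\cos\alpha$ for $i\ne j$. *)

theory Defs
  imports "HOL-Analysis.Analysis"
begin

definition spherical_code :: "nat \<Rightarrow> real \<Rightarrow> (real ^ 'n) set \<Rightarrow> bool" where
  "spherical_code N \<alpha> C \<longleftrightarrow>
     finite C \<and> card C = N \<and> (\<forall>x\<in>C. norm x = 1) \<and>
     (\<forall>x\<in>C. \<forall>y\<in>C. x \<noteq> y \<longrightarrow> x \<bullet> y \<le> cos \<alpha>)"

(* Only the values for t in [-1, 1] are meaningful; inner products of unit vectors lie there. *)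
definition f_code :: "real \<Rightarrow> real \<Rightarrow> real" where
  "f_code \<alpha> t =
     (let z = cos \<alpha> in
        if t < - sqrt z then (z - t\<^sup>2) / (1 - z)
        else if t \<le> z then 0
        else (t - z) / (1 - z))"

definition diagonally_dominant :: "real ^ 'm ^ 'm \<Rightarrow> bool" where
  "diagonally_dominant A \<longleftrightarrow> (\<forall>i. 2 * A $ i $ i \<ge> (\<Sum>j\<in>UNIV. \<bar>A $ i $ j\<bar>))"

definition positive_semidefinite :: "real ^ 'm ^ 'm \<Rightarrow> bool" where
  "positive_semidefinite A \<longleftrightarrow> transpose A = A \<and> (\<forall>v. v \<bullet> (A *v v) \<ge> 0)"

end

(* Only the code vectors y with <e,y> < -sqrt z contribute off-diagonal terms to the row of a
   code vector e. Testing w = sum_y -<e,y> y against e, with S = sum_y <e,y>^2 and m such vectors,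
   Cauchy-Schwarz gives S^2 = <w,e>^2 <= |w|^2 <= (1-z) S + z (sum_y <e,y>)^2 <= (1-z) S + z m S,
   so sum_y (<e,y>^2 - z) = S - m z <= 1 - z, which is diagonal dominance. *)
theory Submission
  imports Defs
begin

lemma sum_inner_squares_le:
  fixes e :: "'a::real_inner" and x :: "'i \<Rightarrow> 'a" and z :: real
  assumes fin: "finite J" and z: "0 \<le> z" "z < 1" and e: "norm e = 1"
    and norm: "\<And>j. j \<in> J \<Longrightarrow> norm (x j) = 1"
    and neg: "\<And>j. j \<in> J \<Longrightarrow> e \<bullet> x j \<le> 0"
    and sep: "\<And>j k. j \<in> J \<Longrightarrow> k \<in> J \<Longrightarrow> j \<noteq> k \<Longrightarrow> x j \<bullet> x k \<le> z"
  shows "(\<Sum>j\<in>J. (e \<bullet> x j)\<^sup>2) \<le> 1 - z + z * card J"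
proof -
  \<comment> \<open>The sign flip makes all weights nonnegative, so the upper bound \<open>z\<close>
    on \<open>x j \<bullet> x k\<close> survives multiplication by \<open>b j * b k\<close>.\<close>
  define b where "b j = - (e \<bullet> x j)" for j
  define S where "S = (\<Sum>j\<in>J. (b j)\<^sup>2)"
  define w where "w = (\<Sum>j\<in>J. b j *\<^sub>R x j)"
  have b0: "0 \<le> b j" if "j \<in> J" for j using neg[OF that] by (simp add: b_def)
  have "e \<bullet> w = - S"
    by (simp add: w_def S_def b_def inner_sum_right power2_eq_square sum_negf)
  then have "S\<^sup>2 \<le> w \<bullet> w"
    using Cauchy_Schwarz_ineq[of e w] e by (simp add: norm_eq_1)
  also have "w \<bullet> w = (\<Sum>j\<in>J. \<Sum>k\<in>J. b j * b k * (x j \<bullet> x k))"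
    by (simp add: w_def inner_sum_left inner_sum_right sum_distrib_left mult_ac inner_commute)
  \<comment> \<open>Entrywise, the Gram matrix is at most z times the all-ones matrix plus (1 - z)
    times the identity: the diagonal entries 1 split as z + (1 - z).\<close>
  also have "\<dots> \<le> (\<Sum>j\<in>J. \<Sum>k\<in>J. z * (b j * b k) + (if j = k then (1 - z) * (b j)\<^sup>2 else 0))"
  proof (intro sum_mono)
    fix j k assume jk: "j \<in> J" "k \<in> J"
    show "b j * b k * (x j \<bullet> x k) \<le> z * (b j * b k) + (if j = k then (1 - z) * (b j)\<^sup>2 else 0)"
    proof (cases "j = k")
      case True
      then show ?thesis
        using norm[OF jk(1)] by (simp add: norm_eq_1 power2_eq_square algebra_simps)
    next
      case False
      then show ?thesis
        using mult_left_mono[OF sep[OF jk False], of "b j * b k"] b0 jk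
        by (simp add: mult_ac)
    qed
  qed
  also have "\<dots> = z * (\<Sum>j\<in>J. b j)\<^sup>2 + (1 - z) * S"
    using fin by (simp add: sum.distrib S_def power2_eq_square sum_product
        flip: sum_distrib_left)
  \<comment> \<open>Cauchy-Schwarz against the all-ones vector bounds the squared sum of the
    \<open>b j\<close> by \<open>S * card J\<close>.\<close>
  also have "\<dots> \<le> z * (S * card J) + (1 - z) * S"
    using sum_squared_le_sum_of_squares[of b J] z
    by (simp add: S_def mult_left_mono mult_ac)
  finally have *: "S * S \<le> S * (1 - z + z * card J)"
    by (simp add: power2_eq_square algebra_simps)
  have "0 \<le> S" by (simp add: S_def sum_nonneg)
  then have "S \<le> 1 - z + z * card J"
    \<comment> \<open>A positive \<open>S\<close> cancels from both sides; for \<open>S = 0\<close>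
      the right-hand side is nonnegative anyway.\<close>
    using * z by (cases "S = 0") (auto intro: mult_left_le_imp_le)
  then show ?thesis by (simp add: S_def b_def)
qed

text \<open>An elementary argument without eigenvalues: each off-diagonal term of the quadratic form
  is at least -|a_ij| (v_i^2 + v_j^2) / 2, and by symmetry these losses add up to row sums, which
  the diagonal absorbs.\<close>

lemma diagonally_dominant_imp_positive_semidefinite:
  fixes A :: "real ^ 'm::finite ^ 'm"
  assumes sym: "transpose A = A" and dd: "diagonally_dominant A"
  shows "positive_semidefinite A"
  unfolding positive_semidefinite_def
proof (intro conjI allI sym)
  fix v :: "real ^ 'm"
  have sym': "A $ j $ i = A $ i $ j" for i j
    using sym by (metis transpose_def vec_lambda_beta)
  have row: "(\<Sum>j\<in>UNIV. \<bar>A $ i $ j\<bar>) \<le> 2 * A $ i $ i" for i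
    using dd by (simp add: diagonally_dominant_def)
  have diag: "0 \<le> A $ i $ i" for i
  proof -
    have "0 \<le> (\<Sum>j\<in>UNIV. \<bar>A $ i $ j\<bar>)" by (intro sum_nonneg) simp
    then show ?thesis using row[of i] by linarith
  qed
  \<comment> \<open>Symmetry trades the weight v_j^2 for v_i^2, so the two halves below merge into
    one full row sum.\<close>
  have "(\<Sum>i\<in>UNIV. \<Sum>j\<in>UNIV. \<bar>A $ i $ j\<bar> * (v $ j)\<^sup>2)
      = (\<Sum>i\<in>UNIV. \<Sum>j\<in>UNIV. \<bar>A $ i $ j\<bar> * (v $ i)\<^sup>2)"
    by (subst sum.swap) (simp add: sym')
  then have "(\<Sum>i\<in>UNIV. \<Sum>j\<in>UNIV. (if i = j then 2 * A $ i $ i * (v $ i)\<^sup>2 else 0)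
        - (\<bar>A $ i $ j\<bar> * (v $ i)\<^sup>2 / 2 + \<bar>A $ i $ j\<bar> * (v $ j)\<^sup>2 / 2))
      = (\<Sum>i\<in>UNIV. (2 * A $ i $ i - (\<Sum>j\<in>UNIV. \<bar>A $ i $ j\<bar>)) * (v $ i)\<^sup>2)"
    by (simp add: sum_subtractf sum.distrib left_diff_distrib sum_distrib_right
        flip: sum_divide_distrib)
  moreover have "0 \<le> \<dots>"
    using row by (intro sum_nonneg mult_nonneg_nonneg) auto
  \<comment> \<open>The subtracted row sums include j = i, hence the factor 2 on the diagonal: as
    a_ii is nonnegative, exactly a_ii v_i^2 remains there. Off the diagonal the bound is the
    inequality 2|v_i v_j| \<le> v_i^2 + v_j^2.\<close>
  moreover have "(\<Sum>i\<in>UNIV. \<Sum>j\<in>UNIV. (if i = j then 2 * A $ i $ i * (v $ i)\<^sup>2 else 0)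
        - (\<bar>A $ i $ j\<bar> * (v $ i)\<^sup>2 / 2 + \<bar>A $ i $ j\<bar> * (v $ j)\<^sup>2 / 2))
      \<le> (\<Sum>i\<in>UNIV. \<Sum>j\<in>UNIV. A $ i $ j * (v $ i * v $ j))"
  proof (intro sum_mono)
    fix i j
    show "(if i = j then 2 * A $ i $ i * (v $ i)\<^sup>2 else 0)
        - (\<bar>A $ i $ j\<bar> * (v $ i)\<^sup>2 / 2 + \<bar>A $ i $ j\<bar> * (v $ j)\<^sup>2 / 2) \<le> A $ i $ j * (v $ i * v $ j)"
    proof (cases "i = j")
      case True
      then show ?thesis using diag[of j] by (simp add: power2_eq_square)
    next
      case False
      have "2 * \<bar>v $ i * v $ j\<bar> \<le> (v $ i)\<^sup>2 + (v $ j)\<^sup>2"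
        using sum_squares_bound[of "\<bar>v $ i\<bar>" "\<bar>v $ j\<bar>"] by (simp add: abs_mult mult_ac)
      then have "\<bar>A $ i $ j\<bar> * (2 * \<bar>v $ i * v $ j\<bar>) \<le> \<bar>A $ i $ j\<bar> * ((v $ i)\<^sup>2 + (v $ j)\<^sup>2)"
        by (intro mult_left_mono) auto
      moreover have "- (\<bar>A $ i $ j\<bar> * \<bar>v $ i * v $ j\<bar>) \<le> A $ i $ j * (v $ i * v $ j)"
        using abs_ge_minus_self[of "A $ i $ j * (v $ i * v $ j)"] by (simp add: abs_mult)
      ultimately show ?thesis using False by (simp add: distrib_left)
    qed
  qed
  moreover have "v \<bullet> (A *v v) = (\<Sum>i\<in>UNIV. \<Sum>j\<in>UNIV. A $ i $ j * (v $ i * v $ j))"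
    by (simp add: inner_vec_def matrix_vector_mult_def sum_distrib_left mult_ac)
  ultimately show "0 \<le> v \<bullet> (A *v v)" by linarith
qed

theorem mainTheorem2:
  fixes \<alpha> :: real
    and C :: "(real ^ 'n) set"
    and x :: "'m::finite \<Rightarrow> real ^ 'n"
  assumes "0 \<le> \<alpha>" and "\<alpha> \<le> pi"
    and "0 \<le> cos \<alpha>" and "cos \<alpha> < 1"
    and "spherical_code CARD('m) \<alpha> C"
    and "bij_betw x UNIV C"
  shows "diagonally_dominant (\<chi> i j. f_code \<alpha> (x i \<bullet> x j)) \<and>
         positive_semidefinite (\<chi> i j. f_code \<alpha> (x i \<bullet> x j))"
proof -
  define z where "z = cos \<alpha>"
  have z: "0 \<le> z" "z < 1" using assms by (auto simp: z_def)
  have xC: "x i \<in> C" for i using assms(6) by (auto simp: bij_betw_def)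
  have norm: "norm (x i) = 1" for i
    using assms(5) xC by (auto simp: spherical_code_def)
  have sep: "x i \<bullet> x j \<le> z" if "i \<noteq> j" for i j
    using assms(5) xC that assms(6)
    by (auto simp: spherical_code_def z_def bij_betw_def inj_eq)
  have f_diag: "f_code \<alpha> (x i \<bullet> x i) = 1" for i
  proof -
    have "\<not> 1 < - sqrt z" using real_sqrt_ge_zero[OF z(1)] by linarith
    moreover have "x i \<bullet> x i = 1" using norm by (simp add: norm_eq_1)
    ultimately show ?thesis
      using z by (simp add: f_code_def Let_def flip: z_def)
  qed
  \<comment> \<open>Since the diagonal entries are 1, this is the dominance condition; it leaves at
    most 1 for the off-diagonal part of each row.\<close>
  have dd: "(\<Sum>j\<in>UNIV. \<bar>f_code \<alpha> (x i \<bullet> x j)\<bar>) \<le> 2" for i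
  proof -
    define J where "J = {j. x i \<bullet> x j < - sqrt z}"
    \<comment> \<open>On \<open>J\<close> the first branch of \<open>f_code\<close> is negative,
      because t < - sqrt z gives t^2 > z, so the absolute value reverses its sign. The index
      \<open>i\<close> itself is not in \<open>J\<close>.\<close>
    have "\<bar>f_code \<alpha> (x i \<bullet> x j)\<bar>
        = (if j = i then 1 else 0) + (if j \<in> J then ((x i \<bullet> x j)\<^sup>2 - z) / (1 - z) else 0)" for j
    proof (cases "j = i")
      case True
      have "\<not> 1 < - sqrt z" using real_sqrt_ge_zero[OF z(1)] by linarith
      moreover have "x i \<bullet> x i = 1" using norm by (simp add: norm_eq_1)
      ultimately have "j \<notin> J" using True by (simp add: J_def)
      then show ?thesis using True f_diag by simp
    next
      case ne: False
      show ?thesis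
      proof (cases "j \<in> J")
        case True
        then have "sqrt z < \<bar>x i \<bullet> x j\<bar>" by (simp add: J_def)
        then have "z < (x i \<bullet> x j)\<^sup>2"
          by (metis real_sqrt_abs real_sqrt_less_iff)
        then show ?thesis
          using True ne z by (simp add: J_def f_code_def Let_def abs_divide flip: z_def)
      next
        case False
        then show ?thesis
          \<comment> \<open>Separation of distinct code vectors rules out the last branch of
            \<open>f_code\<close>, leaving the value 0.\<close>
          using ne sep[of i j] by (simp add: J_def f_code_def Let_def flip: z_def)
      qed
    qed
    then have "(\<Sum>j\<in>UNIV. \<bar>f_code \<alpha> (x i \<bullet> x j)\<bar>)
        = 1 + (\<Sum>j\<in>J. ((x i \<bullet> x j)\<^sup>2 - z) / (1 - z))"
      by (simp add: sum.distrib sum.If_cases)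
    also have "(\<Sum>j\<in>J. ((x i \<bullet> x j)\<^sup>2 - z) / (1 - z))
        = ((\<Sum>j\<in>J. (x i \<bullet> x j)\<^sup>2) - z * card J) / (1 - z)"
      by (simp add: sum_subtractf mult_ac flip: sum_divide_distrib)
    also have "\<dots> \<le> 1"
    proof -
      have "x i \<bullet> x j \<le> 0" if "j \<in> J" for j
        using that real_sqrt_ge_zero[OF z(1)] unfolding J_def mem_Collect_eq by linarith
      \<comment> \<open>The vector \<open>x i\<close> serves as \<open>e\<close>. Moving
        \<open>z * card J\<close> to the left and dividing by the positive number 1 - z gives the
        required bound 1.\<close>
      then have "(\<Sum>j\<in>J. (x i \<bullet> x j)\<^sup>2) \<le> 1 - z + z * card J"
        using z norm sep by (intro sum_inner_squares_le) auto
      then show ?thesis using z by simp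
    qed
    finally show ?thesis by simp
  qed
  have "diagonally_dominant (\<chi> i j. f_code \<alpha> (x i \<bullet> x j))"
    using dd by (simp add: diagonally_dominant_def f_diag)
  moreover have "transpose (\<chi> i j. f_code \<alpha> (x i \<bullet> x j)) = (\<chi> i j. f_code \<alpha> (x i \<bullet> x j))"
    by (simp add: transpose_def vec_eq_iff inner_commute)
  ultimately show ?thesis
    using diagonally_dominant_imp_positive_semidefinite by blast
qed

end
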